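(* Let $\ell\ge1$, $m\ge1$, let $\nu=(k_0,\dots,k_\ell)$ be a weight of $B_\ell(m)$ (that is, $k_i\in\mathbb N$, $\sum_{i=0}^\ell k_i=m$), and let $n\in\{0,\dots,m-1\}$. Then the cardinality of the set $B_\ell(m)_\nu^{-n}=\{b\in B_\ell(m)_\nu: N(b)\equiv -n \pmod m\}$ equals the coefficient of $q^n$ in the polynomial $$\begin{bmatrix} m\\ k_0,\dots,k_\ell\end{bmatrix}\pmod{q^m-1},$$ i.e. in the remainder of the $q$-multinomial coefficient upon division by $q^m-1$.
   Context: $B_\ell(m)$ is the set of formal products (words) $b=b_{i_m}\otimes\cdots\otimes b_{i_1}$ with $i_1,\dots,i_m\in\{0,\dots,\ell\}$. The weight of $b$ is identified with the tuple $(k_0,\dots,k_\ell)$, $k_i=\#\{r: i_r=i\}$, and $B_\ell(m)_\nu$ is the set of $b\in B_\ell(m)$ of weight $\nu$. For $b=b_{i_m}\otimes\cdots\otimes b_{i_1}$ let $\operatorname{desc}(b)=\{r: 1\le r<m,\ i_r>i_{r+1}\}$ (usual order on $\{0,\dots,\ell\}$), $k=\#\operatorname{desc}(b)+1$, write $\operatorname{desc}(b)=\{n_1<\dots<n_{k-1}\}$, $n_0=0$, $n_k=m$, and set $N(b)=\sum_{r=1}^k r(n_r-n_{r-1})$. $[n]=1+q+\dots+q^{n-1}$, $[n]!=[n][n-1]\cdots[1]$, and $\begin{bmatrix} n\\ n_1,\dots,n_k\end{bmatrix}=\dfrac{[n]!}{[n_1]!\cdots[n_k]!}$ for $n=n_1+\dots+n_k$.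 *)

theory Defs
  imports "HOL-Computational_Algebra.Polynomial" "HOL-Number_Theory.Cong"
begin

text \<open>The word \<open>b\<^bsub>i\<^sub>m\<^esub> \<otimes> \<dots> \<otimes> b\<^bsub>i\<^sub>1\<^esub>\<close> is encoded as the list \<open>[i\<^sub>1, \<dots>, i\<^sub>m]\<close> of its indices, i.e. the
  tensor factors are listed from right to left, so that \<open>i\<^sub>r = b ! (r - 1)\<close>.\<close>

definition letter :: "nat list \<Rightarrow> nat \<Rightarrow> nat" where
  "letter b r = b ! (r - 1)"

definition words :: "nat \<Rightarrow> nat \<Rightarrow> nat list set" where
  "words l m = {b. length b = m \<and> set b \<subseteq> {0..l}}"

text \<open>A weight \<open>(k\<^sub>0, \<dots>, k\<^sub>l)\<close> is a function \<open>k\<close> of which only the values at \<open>0, \<dots>, l\<close> matter.\<close>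

definition words_wt :: "nat \<Rightarrow> nat \<Rightarrow> (nat \<Rightarrow> nat) \<Rightarrow> nat list set" where
  "words_wt l m k =
     {b \<in> words l m. \<forall>i\<in>{0..l}. card {r \<in> {1..m}. letter b r = i} = k i}"

definition desc :: "nat list \<Rightarrow> nat set" where
  "desc b = {r. 1 \<le> r \<and> r < length b \<and> letter b r > letter b (r + 1)}"

text \<open>The list \<open>[n\<^sub>0, n\<^sub>1, \<dots>, n\<^sub>k]\<close>, with \<open>n\<^sub>0 = 0\<close> and \<open>n\<^sub>k = m\<close>. It is increasing, so the
  natural-number subtraction in \<open>N_stat\<close> does not truncate.\<close>

definition breaks :: "nat list \<Rightarrow> nat list" where
  "breaks b = 0 # sorted_list_of_set (desc b) @ [length b]"

definition N_stat :: "nat list \<Rightarrow> nat" where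
  "N_stat b = (\<Sum>r = 1..card (desc b) + 1. r * (breaks b ! r - breaks b ! (r - 1)))"

definition words_wt_res :: "nat \<Rightarrow> nat \<Rightarrow> (nat \<Rightarrow> nat) \<Rightarrow> int \<Rightarrow> nat list set" where
  "words_wt_res l m k c = {b \<in> words_wt l m k. [int (N_stat b) = c] (mod int m)}"

text \<open>Polynomials in \<open>q\<close> are taken over the rationals, where division with remainder by any nonzero
  polynomial is available; as \<open>q\<^sup>m - 1\<close> is monic, remainders of integer polynomials
  are the same as over the integers.\<close>

definition qint :: "nat \<Rightarrow> rat poly" where
  "qint n = (\<Sum>i<n. monom 1 i)"

definition qfact :: "nat \<Rightarrow> rat poly" where
  "qfact n = (\<Prod>j = 1..n. qint j)"

definition qmultinomial :: "nat \<Rightarrow> nat \<Rightarrow> (nat \<Rightarrow> nat) \<Rightarrow> rat poly" where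
  "qmultinomial m l k = qfact m div (\<Prod>i = 0..l. qfact (k i))"

text \<open>The division in \<open>qmultinomial\<close> is exact.\<close>

lemma qint_add: "qint (a + b) = qint a + monom 1 a * qint b"
proof (induction b)
  case (Suc b)
  then show ?case
    by (simp add: qint_def algebra_simps mult_monom)
qed (simp add: qint_def)

lemma qfact_0: "qfact 0 = 1"
  by (simp add: qfact_def)

lemma qfact_Suc: "qfact (Suc n) = qint (Suc n) * qfact n"
  by (simp add: qfact_def mult.commute)

lemma qfact_mult_dvd: "qfact a * qfact b dvd qfact (a + b)"
proof (induction "a + b" arbitrary: a b)
  case 0
  then show ?case by (simp add: qfact_0)
next
  case (Suc n)
  show ?case
  proof (cases "a = 0 \<or> b = 0")
    case True
    then show ?thesis by (auto simp: qfact_0)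
  next
    case False
    then obtain a' b' where ab: "a = Suc a'" "b = Suc b'"
      by (metis not0_implies_Suc)
    have n: "n = a' + b" "n = a + b'" using Suc.hyps(2) ab by auto
    have "qfact (a + b) = qint (a + b) * qfact n"
      using Suc.hyps(2) by (metis qfact_Suc)
    also have "\<dots> = qint a * qfact n + monom 1 a * (qint b * qfact n)"
      by (simp add: qint_add algebra_simps)
    finally have eq: "qfact (a + b) = qint a * qfact n + monom 1 a * (qint b * qfact n)" .
    have "qint a * (qfact a' * qfact b) dvd qint a * qfact n"
      using Suc.hyps(1)[OF n(1)] n(1) by (intro mult_dvd_mono) auto
    then have 1: "qfact a * qfact b dvd qint a * qfact n"
      by (simp add: ab(1) qfact_Suc mult.assoc)
    have "qint b * (qfact a * qfact b') dvd qint b * qfact n"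
      using Suc.hyps(1)[OF n(2)] n(2) by (intro mult_dvd_mono) auto
    then have 2: "qfact a * qfact b dvd qint b * qfact n"
      by (simp add: ab(2) qfact_Suc mult.left_commute)
    show ?thesis unfolding eq by (rule dvd_add[OF 1 dvd_mult[OF 2]])
  qed
qed

lemma prod_qfact_dvd:
  fixes l :: nat and k :: "nat \<Rightarrow> nat"
  shows "(\<Prod>i = 0..l. qfact (k i)) dvd qfact (\<Sum>i = 0..l. k i)"
proof (induction l)
  case (Suc l)
  have "(\<Prod>i = 0..Suc l. qfact (k i)) dvd qfact (\<Sum>i = 0..l. k i) * qfact (k (Suc l))"
    using Suc by (simp add: mult_dvd_mono)
  also have "\<dots> dvd qfact (\<Sum>i = 0..Suc l. k i)"
    using qfact_mult_dvd by simp
  finally show ?case .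
qed simp

lemma qmultinomial_exact:
  assumes "(\<Sum>i = 0..l. k i) = m"
  shows "qmultinomial m l k * (\<Prod>i = 0..l. qfact (k i)) = qfact m"
  using prod_qfact_dvd[of k l] assms by (simp add: qmultinomial_def)

end

theory Submission
  imports Defs
begin

text \<open>Abel summation turns \<open>N(b)\<close> into \<open>(#desc(b) + 1) m - maj(b)\<close>, so the condition on \<open>N(b)\<close> says
  \<open>maj(b) \<equiv> n (mod m)\<close>, and the claim is MacMahon's theorem that the major index is distributed
  over the words of weight \<open>(k\<^sub>0, \<dots>, k\<^sub>l)\<close> as the \<open>q\<close>-multinomial coefficient, read modulo \<open>q\<^sup>m - 1\<close>.
  MacMahon's theorem is refined by the last letter \<open>j\<close> of the word: the words ending in \<open>j\<close>
  contribute \<open>q\<close> to the power \<open>k\<^bsub>j+1\<^esub> + \<dots> + k\<^sub>l\<close>, times the \<open>q\<close>-multinomial coefficient of the weight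
  with \<open>k\<^sub>j\<close> lowered by one. In this form it follows by induction on the length, removing the last
  letter.\<close>

definition maj :: "nat list \<Rightarrow> nat" where
  "maj b = \<Sum>(desc b)"

section \<open>From \<open>N_stat\<close> to the major index\<close>

lemma finite_desc [simp]: "finite (desc b)"
  by (rule finite_subset[of _ "{..length b}"]) (auto simp: desc_def)

text \<open>Abel summation, in a ring so that differences do not truncate. The sum on the right
  includes \<open>x 0\<close>.\<close>

lemma sum_mult_diff:
  fixes x :: "nat \<Rightarrow> 'a::comm_ring_1"
  shows "(\<Sum>r = 1..n. of_nat r * (x r - x (r - 1))) = of_nat n * x n - (\<Sum>r<n. x r)"
  by (induction n) (simp_all add: algebra_simps)

text \<open>Abel summation on \<open>breaks b\<close>: the final entry is \<open>length b\<close>,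
  and the entries before it are \<open>0\<close> and the descents, which add up to
  \<open>maj b\<close>.\<close>

lemma N_stat_eq_maj: "int (N_stat b) = int (card (desc b) + 1) * int (length b) - int (maj b)"
proof -
  let ?K = "card (desc b)" and ?s = "sorted_list_of_set (desc b)"
  have len: "length ?s = ?K" by simp
  have "sorted (breaks b)"
    by (auto simp: breaks_def sorted_append desc_def)
  then have mono: "breaks b ! (r - 1) \<le> breaks b ! r" if "r \<le> ?K + 1" for r
    using that len by (intro sorted_nth_mono) (auto simp: breaks_def)
  have last: "breaks b ! (?K + 1) = length b"
    by (simp add: breaks_def nth_append)
  have "(\<Sum>r<?K + 1. breaks b ! r) = (\<Sum>r<?K + 1. (0 # ?s) ! r)"
    by (intro sum.cong) (auto simp: breaks_def nth_append nth_Cons split: nat.split)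
  also have "\<dots> = sum_list (0 # ?s)"
    using len by (simp only: sum_list_sum_nth atLeast0LessThan) simp
  also have "\<dots> = maj b"
    by (simp add: maj_def distinct_sum_list_conv_Sum)
  finally have sum: "(\<Sum>r<?K + 1. breaks b ! r) = maj b" .
  have "int (N_stat b) =
      (\<Sum>r = 1..?K + 1. of_nat r * (int (breaks b ! r) - int (breaks b ! (r - 1))))"
    unfolding N_stat_def of_nat_sum
    by (intro sum.cong) (use mono in \<open>simp_all add: of_nat_diff\<close>)
  also have "\<dots> = int (?K + 1) * int (length b) - int (maj b)"
    unfolding sum_mult_diff[where x = "\<lambda>r. int (breaks b ! r)"] last sum[symmetric] by simp
  finally show ?thesis .
qed

lemma cong_N_stat_iff:
  assumes "length b = m"
  shows "[int (N_stat b) = - int n] (mod int m) \<longleftrightarrow> [maj b = n] (mod m)"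
proof -
  have "int (N_stat b) - - int n = int m * int (card (desc b) + 1) - (int (maj b) - int n)"
    using assms by (simp add: N_stat_eq_maj algebra_simps)
  then have "[int (N_stat b) = - int n] (mod int m) \<longleftrightarrow>
      int m dvd int m * int (card (desc b) + 1) - (int (maj b) - int n)"
    by (simp only: cong_iff_dvd_diff)
  also have "\<dots> \<longleftrightarrow> int m dvd int (maj b) - int n"
    by (rule dvd_diff_right_iff) simp
  also have "\<dots> \<longleftrightarrow> [maj b = n] (mod m)"
    by (simp add: cong_iff_dvd_diff flip: cong_int_iff)
  finally show ?thesis .
qed

section \<open>Removing the last letter of a word\<close>

lemma maj_singleton [simp]: "maj [j] = 0"
proof -
  have "desc [j] = {}" by (auto simp: desc_def)
  then show ?thesis by (simp add: maj_def)
qed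

text \<open>Appending a letter keeps all earlier descents; the only possible new one is at position
  \<open>length w\<close>, where \<open>last w\<close> meets \<open>j\<close>.\<close>

lemma maj_snoc:
  assumes "w \<noteq> []"
  shows "maj (w @ [j]) = maj w + (if j < last w then length w else 0)"
proof -
  have "letter (w @ [j]) r = letter w r" if "1 \<le> r" "r \<le> length w" for r
    using that by (auto simp: letter_def nth_append)
  moreover have "letter (w @ [j]) (length w) = last w" "letter (w @ [j]) (Suc (length w)) = j"
    using assms by (auto simp: letter_def nth_append last_conv_nth)
  moreover have "length w \<ge> 1" using assms by (cases w) auto
  ultimately have "desc (w @ [j]) = desc w \<union> (if j < last w then {length w} else {})"
    by (auto simp: desc_def less_Suc_eq)
  then show ?thesis
    by (auto simp: maj_def desc_def sum.union_disjoint)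
qed

lemma words_wt_count_list:
  "words_wt l m k = {w. length w = m \<and> set w \<subseteq> {0..l} \<and> (\<forall>i\<in>{0..l}. count_list w i = k i)}"
proof -
  have "card {r \<in> {1..length w}. letter w r = i} = count_list w i" for w i
  proof -
    \<comment> \<open>Letters are numbered from 1, list positions from 0.\<close>
    have "{r \<in> {1..length w}. letter w r = i} = Suc ` {r. r < length w \<and> w ! r = i}"
      by (auto simp: letter_def image_iff Suc_le_eq gr0_conv_Suc)
    then have "card {r \<in> {1..length w}. letter w r = i} = card {r. r < length w \<and> w ! r = i}"
      by (simp only: card_image inj_Suc)
    then show ?thesis
      by (simp only: count_list_eq_length_filter length_filter_conv_card eq_commute[of i])
  qed
  then show ?thesis
    unfolding words_wt_def words_def by auto
qed

lemma finite_words_wt [simp]: "finite (words_wt l m k)"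
  by (rule finite_subset[OF _ finite_lists_length_eq[of "{0..l}" m]])
    (auto simp: words_wt_def words_def)

text \<open>Removing the final \<open>j\<close> is inverse to appending it. Positivity of
  \<open>k j\<close> keeps \<open>k j - 1\<close> from truncating.\<close>

lemma words_wt_last:
  assumes "j \<le> l" and "k j > 0"
  shows "{w \<in> words_wt l (Suc m) k. last w = j} = (\<lambda>w. w @ [j]) ` words_wt l m (k(j := k j - 1))"
    (is "?A = ?B")
proof
  show "?A \<subseteq> ?B"
  proof
    fix w assume w: "w \<in> ?A"
    then have "w \<noteq> []" "last w = j" by (auto simp: words_wt_count_list)
    then obtain v where v: "w = v @ [j]" by (metis append_butlast_last_id)
    have "v \<in> words_wt l m (k(j := k j - 1))"
      using w unfolding v words_wt_count_list by (auto split: if_splits)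
    then show "w \<in> ?B" using v by blast
  qed
  show "?B \<subseteq> ?A"
    using assms by (auto simp: words_wt_count_list)
qed

lemma words_wt_last_empty:
  assumes "j \<le> l" and "k j = 0" and "m > 0"
  shows "{w \<in> words_wt l m k. last w = j} = {}"
proof -
  have False if "w \<in> words_wt l m k" "last w = j" for w
  proof -
    have "w \<noteq> []" "count_list w j = 0"
      using that assms by (auto simp: words_wt_count_list)
    then show False
      using that(2) last_in_set[of w] by (simp add: count_list_0_iff)
  qed
  then show ?thesis by blast
qed

lemma sum_words_wt_last:
  fixes f :: "nat list \<Rightarrow> 'a::comm_monoid_add"
  assumes "m > 0"
  shows "(\<Sum>w\<in>words_wt l m k. f w) =
    (\<Sum>i = 0..<Suc l. \<Sum>w | w \<in> words_wt l m k \<and> last w = i. f w)"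
proof (rule sum.group[symmetric])
  show "last ` words_wt l m k \<subseteq> {0..<Suc l}"
  proof
    fix i assume "i \<in> last ` words_wt l m k"
    then obtain w where w: "w \<in> words_wt l m k" "i = last w" by blast
    then have "w \<noteq> []" "set w \<subseteq> {0..l}" using assms by (auto simp: words_wt_count_list)
    then show "i \<in> {0..<Suc l}" using last_in_set[of w] w(2) by fastforce
  qed
qed simp_all

section \<open>MacMahon's theorem refined by the last letter\<close>

text \<open>Iterating \<open>qint_add\<close> cuts the \<open>q\<close>-integer of
  \<open>k a + ... + k (c - 1)\<close> into blocks, the highest index first: block \<open>i\<close>
  is shifted by the sizes of the blocks above it. The indices from \<open>c\<close> on only add a
  common shift. Hence the induction lowers \<open>a\<close>, starting from \<open>c\<close>.\<close>

lemma sum_qint_tail: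
  assumes "a \<le> c" and "c \<le> L"
  shows "(\<Sum>i = a..<c. monom 1 (\<Sum>p = Suc i..<L. k p) * qint (k i)) =
    monom 1 (\<Sum>p = c..<L. k p) * qint (\<Sum>i = a..<c. k i)"
  using assms(1)
proof (induction rule: inc_induct)
  case (step a)
  have "(\<Sum>p = Suc a..<L. k p) = (\<Sum>p = c..<L. k p) + (\<Sum>i = Suc a..<c. k i)"
    using sum.atLeastLessThan_concat[of "Suc a" c L k] step.hyps assms(2) by simp
  moreover have "(\<Sum>i = a..<c. k i) = (\<Sum>i = Suc a..<c. k i) + k a"
    using step.hyps by (simp add: sum.atLeast_Suc_lessThan)
  moreover have "(\<Sum>i = a..<c. monom 1 (\<Sum>p = Suc i..<L. k p) * qint (k i)) =
      monom 1 (\<Sum>p = Suc a..<L. k p) * qint (k a) +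
      monom 1 (\<Sum>p = c..<L. k p) * qint (\<Sum>i = Suc a..<c. k i)"
    using step by (simp add: sum.atLeast_Suc_lessThan)
  ultimately show ?case
    by (simp only: qint_add) (simp add: algebra_simps mult_monom)
qed (simp add: qint_def)

text \<open>Multiplying by the full denominator avoids division: lowering \<open>k j\<close> turns
  \<open>qfact (k j)\<close> into \<open>qfact (k j - 1)\<close>, which leaves the factor
  \<open>qint (k j)\<close>. That factor vanishes for \<open>k j = 0\<close>, so absent letters are
  covered too.\<close>

lemma maj_last_letter:
  assumes "j \<le> l" and "(\<Sum>i = 0..l. k i) = Suc m"
  shows "(\<Sum>w | w \<in> words_wt l (Suc m) k \<and> last w = j. monom 1 (maj w)) * (\<Prod>i = 0..l. qfact (k i))
    = monom 1 (\<Sum>i = Suc j..<Suc l. k i) * qint (k j) * qfact m"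
  using assms
proof (induction m arbitrary: k j)
  case 0
  show ?case
  proof (cases "k j")
    case 0
    then have empty: "{w \<in> words_wt l (Suc 0) k. last w = j} = {}"
      using \<open>j \<le> l\<close> by (simp add: words_wt_last_empty)
    show ?thesis
      unfolding empty using 0 by (simp add: qint_def)
  next
    case (Suc c)
    have split: "(\<Sum>i = 0..l. k i) = k j + (\<Sum>i\<in>{0..l} - {j}. k i)"
      using \<open>j \<le> l\<close> by (simp add: sum.remove)
    then have kj: "k j = 1" and other: "\<And>i. i \<le> l \<Longrightarrow> i \<noteq> j \<Longrightarrow> k i = 0"
      using 0 Suc by auto
    have "{w \<in> words_wt l (Suc 0) k. last w = j} = {[j]}"
      using \<open>j \<le> l\<close> kj other by (auto simp: words_wt_count_list length_Suc_conv)
    moreover have "(\<Prod>i = 0..l. qfact (k i)) = 1"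
    proof (intro prod.neutral ballI)
      fix i assume "i \<in> {0..l}"
      then show "qfact (k i) = 1"
        using kj other by (cases "i = j") (auto simp: qfact_def qint_def)
    qed
    moreover have "(\<Sum>i = Suc j..<Suc l. k i) = 0"
      using other by simp
    ultimately show ?thesis
      using kj by (simp add: qint_def qfact_0)
  qed
next
  case (Suc m)
  show ?case
  proof (cases "k j")
    case 0
    then have empty: "{w \<in> words_wt l (Suc (Suc m)) k. last w = j} = {}"
      using \<open>j \<le> l\<close> by (simp add: words_wt_last_empty)
    show ?thesis
      unfolding empty using 0 by (simp add: qint_def del: sum.op_ivl_Suc)
  next
    case kj: (Suc c)
    define k' where "k' = k(j := k j - 1)"
    \<comment> \<open>\<open>T\<close> counts the letters above \<open>j\<close>; lowering
      \<open>k j\<close> does not affect it.\<close>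
    define T where "T = (\<Sum>p = Suc j..<Suc l. k' p)"
    have T: "T = (\<Sum>p = Suc j..<Suc l. k p)"
      unfolding T_def k'_def by (intro sum.cong) auto
    have "(\<Sum>i = 0..l. k i) = k j + (\<Sum>i\<in>{0..l} - {j}. k i)"
      using \<open>j \<le> l\<close> by (simp add: sum.remove)
    moreover have "(\<Sum>i = 0..l. k' i) = k' j + (\<Sum>i\<in>{0..l} - {j}. k' i)"
      using \<open>j \<le> l\<close> by (simp add: sum.remove)
    moreover have "(\<Sum>i\<in>{0..l} - {j}. k' i) = (\<Sum>i\<in>{0..l} - {j}. k i)"
      by (intro sum.cong) (auto simp: k'_def)
    ultimately have k': "(\<Sum>i = 0..l. k' i) = Suc m"
      using Suc.prems(2) kj by (simp add: k'_def)
    have "(\<Sum>i = 0..<Suc j. k' i) + T = (\<Sum>i = 0..<Suc l. k' i)"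
      unfolding T_def using \<open>j \<le> l\<close> by (intro sum.atLeastLessThan_concat) auto
    then have head: "(\<Sum>i = 0..<Suc j. k' i) + T = Suc m"
      using k' by (simp only: atLeastLessThanSuc_atLeastAtMost)
    define P where "P = (\<Prod>i = 0..l. qfact (k' i))"
    have "(\<Prod>i = 0..l. qfact (k i)) = qfact (k j) * (\<Prod>i\<in>{0..l} - {j}. qfact (k i))"
      using \<open>j \<le> l\<close> by (simp add: prod.remove)
    moreover have "P = qfact (k' j) * (\<Prod>i\<in>{0..l} - {j}. qfact (k' i))"
      unfolding P_def using \<open>j \<le> l\<close> by (simp add: prod.remove)
    moreover have "(\<Prod>i\<in>{0..l} - {j}. qfact (k' i)) = (\<Prod>i\<in>{0..l} - {j}. qfact (k i))"
      by (intro prod.cong) (auto simp: k'_def)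
    ultimately have P: "(\<Prod>i = 0..l. qfact (k i)) = qint (k j) * P"
      using kj by (simp add: k'_def qfact_Suc)
    define M where
      "M i = (\<Sum>w | w \<in> words_wt l (Suc m) k' \<and> last w = i. monom (1::rat) (maj w))" for i
    define E where "E i = monom (1::rat) (\<Sum>p = Suc i..<Suc l. k' p) * qint (k' i)" for i
    have IH: "M i * P = E i * qfact m" if "i \<le> l" for i
      using Suc.IH[OF that k'] by (simp only: M_def P_def E_def)
    have "(\<Sum>w | w \<in> words_wt l (Suc (Suc m)) k \<and> last w = j. monom (1::rat) (maj w)) =
        (\<Sum>w\<in>words_wt l (Suc m) k'. monom 1 (maj (w @ [j])))"
      using words_wt_last[OF \<open>j \<le> l\<close>, of k "Suc m"] kj
      by (simp add: k'_def sum.reindex inj_on_def)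
    also have "\<dots> = (\<Sum>i = 0..<Suc l. \<Sum>w | w \<in> words_wt l (Suc m) k' \<and> last w = i.
        monom 1 (maj (w @ [j])))"
      by (rule sum_words_wt_last) simp
    \<comment> \<open>If the shortened word ends in \<open>i > j\<close>, the final \<open>j\<close>
      creates a descent at position \<open>Suc m\<close>.\<close>
    also have "\<dots> = (\<Sum>i = 0..<Suc l. (if j < i then monom 1 (Suc m) else 1) * M i)"
      unfolding M_def sum_distrib_left
    proof (intro sum.cong refl)
      fix i w assume "w \<in> {w \<in> words_wt l (Suc m) k'. last w = i}"
      then have "w \<noteq> []" "length w = Suc m" "last w = i"
        by (auto simp: words_wt_count_list)
      then show "monom 1 (maj (w @ [j])) =
          (if j < i then monom 1 (Suc m) else 1) * monom (1::rat) (maj w)"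
        by (simp add: maj_snoc mult_monom add.commute)
    qed
    finally have "(\<Sum>w | w \<in> words_wt l (Suc (Suc m)) k \<and> last w = j. monom 1 (maj w)) * P =
        (\<Sum>i = 0..<Suc l. (if j < i then monom 1 (Suc m) else 1) * (M i * P))"
      by (simp only: sum_distrib_right mult.assoc)
    also have "\<dots> = (\<Sum>i = 0..<Suc l. (if j < i then monom 1 (Suc m) else 1) * E i) * qfact m"
      unfolding sum_distrib_right
      by (intro sum.cong refl) (simp only: IH less_Suc_eq_le atLeastLessThan_iff mult.assoc)
    also have "(\<Sum>i = 0..<Suc l. (if j < i then monom 1 (Suc m) else 1) * E i) =
        (\<Sum>i = 0..<Suc j. (if j < i then monom 1 (Suc m) else 1) * E i) +
        (\<Sum>i = Suc j..<Suc l. (if j < i then monom 1 (Suc m) else 1) * E i)"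
      using \<open>j \<le> l\<close> by (intro sum.atLeastLessThan_concat[symmetric]) auto
    also have "\<dots> = (\<Sum>i = 0..<Suc j. E i) + monom 1 (Suc m) * (\<Sum>i = Suc j..<Suc l. E i)"
      unfolding sum_distrib_left by (intro arg_cong2[of _ _ _ _ "(+)"] sum.cong) auto
    also have "(\<Sum>i = 0..<Suc j. E i) = monom 1 T * qint (\<Sum>i = 0..<Suc j. k' i)"
      unfolding E_def T_def using \<open>j \<le> l\<close> by (intro sum_qint_tail) auto
    \<comment> \<open>Here the block runs up to the top index, so the common shift is
      \<open>monom 1 0 = 1\<close>.\<close>
    also have "(\<Sum>i = Suc j..<Suc l. E i) = qint T"
      unfolding E_def T_def using \<open>j \<le> l\<close> by (subst sum_qint_tail) auto
    \<comment> \<open>With \<open>A\<close> letters at most \<open>j\<close> in the shortened word,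
      \<open>A + T = Suc m\<close>; taking out \<open>q^T\<close> leaves
      \<open>[A] + q^A [T] = [A + T]\<close>.\<close>
    also have "monom 1 T * qint (\<Sum>i = 0..<Suc j. k' i) + monom 1 (Suc m) * qint T =
        monom 1 T * qint (Suc m)"
      unfolding head[symmetric] qint_add by (simp add: algebra_simps mult_monom)
    \<comment> \<open>The factor \<open>qint (k j)\<close> turns \<open>P\<close>, the denominator
      for \<open>k'\<close>, into the one for \<open>k\<close>.\<close>
    finally have "qint (k j) *
        ((\<Sum>w | w \<in> words_wt l (Suc (Suc m)) k \<and> last w = j. monom 1 (maj w)) * P) =
        qint (k j) * (monom 1 T * qint (Suc m) * qfact m)"
      by (rule arg_cong)
    then show ?thesis
      unfolding P T[symmetric] qfact_Suc by (simp only: mult_ac)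
  qed
qed

section \<open>Reduction modulo \<open>q^m - 1\<close> and the final count\<close>

text \<open>Modulo the divisor \<open>q^m\<close> is 1, so exponents may be reduced modulo
  \<open>m\<close>; the result has degree below \<open>m\<close> and is therefore the remainder
  itself.\<close>

lemma mod_monom_minus_one:
  assumes "m > 0"
  shows "monom 1 a mod (monom 1 m - 1) = (monom 1 (a mod m) :: 'a::field poly)"
proof -
  have "(monom 1 a :: 'a poly) = monom 1 (a mod m) * monom 1 m ^ (a div m)"
    by (simp add: monom_power mult_monom)
  then have "monom 1 a - monom 1 (a mod m) =
      (monom 1 (a mod m) * (monom 1 m ^ (a div m) - 1) :: 'a poly)"
    by (simp add: algebra_simps)
  moreover have "(monom 1 m - 1 :: 'a poly) dvd monom 1 m ^ (a div m) - 1"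
    by (simp add: power_diff_1_eq)
  ultimately have "monom 1 a mod (monom 1 m - 1) =
      (monom 1 (a mod m) mod (monom 1 m - 1) :: 'a poly)"
    by (simp add: mod_eq_dvd_iff)
  also have "\<dots> = monom 1 (a mod m)"
  proof (rule mod_poly_less)
    have "degree (monom 1 m - 1 :: 'a poly) = m"
      using assms by (simp add: degree_monom_eq degree_add_eq_left flip: add_uminus_conv_diff)
    then show "degree (monom 1 (a mod m) :: 'a poly) < degree (monom 1 m - 1 :: 'a poly)"
      using assms by (simp add: degree_monom_eq)
  qed
  finally show ?thesis .
qed

text \<open>Summing \<open>maj_last_letter\<close> over all last letters,
  \<open>sum_qint_tail\<close> over the whole range collapses the coefficients to
  \<open>qint m\<close>, and \<open>[m] [m-1]! = [m]!\<close>.\<close>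

lemma maj_words_wt:
  assumes "(\<Sum>i = 0..l. k i) = m" and "m > 0"
  shows "(\<Sum>w\<in>words_wt l m k. monom 1 (maj w)) = qmultinomial m l k"
proof -
  obtain m' where m: "m = Suc m'" using assms(2) gr0_conv_Suc by blast
  let ?P = "\<Prod>i = 0..l. qfact (k i)"
  \<comment> \<open>Constant coefficient 1 makes the denominator nonzero, so it can be cancelled at
    the end.\<close>
  have "qint n \<noteq> 0" if "n > 0" for n
  proof -
    have "coeff (qint n) 0 = 1"
      using that by (simp add: qint_def coeff_sum)
    then show ?thesis by auto
  qed
  then have P: "?P \<noteq> 0" by (simp add: qfact_def)
  have "(\<Sum>w\<in>words_wt l m k. monom 1 (maj w)) * ?P =
      (\<Sum>i = 0..<Suc l. (\<Sum>w | w \<in> words_wt l m k \<and> last w = i. monom 1 (maj w)) * ?P)"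
    using assms(2) by (simp only: sum_words_wt_last sum_distrib_right[symmetric])
  also have "\<dots> =
      (\<Sum>i = 0..<Suc l. monom 1 (\<Sum>p = Suc i..<Suc l. k p) * qint (k i) * qfact m')"
    using assms(1) unfolding m by (intro sum.cong refl maj_last_letter) auto
  also have "\<dots> = (\<Sum>i = 0..<Suc l. monom 1 (\<Sum>p = Suc i..<Suc l. k p) * qint (k i)) * qfact m'"
    by (rule sum_distrib_right[symmetric])
  also have "(\<Sum>i = 0..<Suc l. monom 1 (\<Sum>p = Suc i..<Suc l. k p) * qint (k i)) = qint m"
    using assms(1)
    by (subst sum_qint_tail)
      (simp_all add: atLeastLessThanSuc_atLeastAtMost del: sum.op_ivl_Suc)
  also have "qint m * qfact m' = qmultinomial m l k * ?P"
    unfolding qmultinomial_exact[OF assms(1)] by (simp add: m qfact_Suc)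
  finally show ?thesis using P by simp
qed

lemma sum_poly_mod:
  fixes f :: "'b \<Rightarrow> 'a::field poly"
  shows "(\<Sum>x\<in>A. f x) mod p = (\<Sum>x\<in>A. f x mod p)"
  by (induction A rule: infinite_finite_induct) (simp_all add: poly_mod_add_left)

theorem lemmaA2:
  fixes l m n :: nat and k :: "nat \<Rightarrow> nat"
  assumes "l \<ge> 1" and "m \<ge> 1"
    and "(\<Sum>i = 0..l. k i) = m"
    and "n \<in> {0..m - 1}"
  shows "of_nat (card (words_wt_res l m k (- int n)))
           = poly.coeff (qmultinomial m l k mod (monom 1 m - 1)) n"
proof -
  have "length b = m" if "b \<in> words_wt l m k" for b
    using that by (simp add: words_wt_count_list)
  \<comment> \<open>Since \<open>n < m\<close>, being congruent to \<open>n\<close> means having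
    remainder exactly \<open>n\<close>.\<close>
  then have "words_wt_res l m k (- int n) = {b \<in> words_wt l m k. maj b mod m = n}"
    using assms(2,4) unfolding words_wt_res_def
    by (intro Collect_cong conj_cong refl) (simp add: cong_N_stat_iff, simp add: cong_def)
  \<comment> \<open>Remainders are additive, so every word contributes one reduced monomial, and the
    coefficient at \<open>n\<close> counts words.\<close>
  moreover have "qmultinomial m l k mod (monom 1 m - 1) =
      (\<Sum>w\<in>words_wt l m k. monom 1 (maj w mod m))"
    using assms(2,3) by (simp add: maj_words_wt[symmetric] sum_poly_mod mod_monom_minus_one)
  then have "coeff (qmultinomial m l k mod (monom 1 m - 1)) n =
      (\<Sum>w\<in>words_wt l m k. if maj w mod m = n then 1 else 0)"
    by (simp add: coeff_sum)
  ultimately show ?thesis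
    by (simp add: sum.If_cases Int_def)
qed

end
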